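(* Let $n\geq 4$. There are only finitely many Erdős matrices in $\mathcal{B}_n$. More precisely, $$\Big|\{A\in\mathcal{B}_n:\ \|A\|_{\mathrm{F}}^2=\mathrm{maxTrace}(A)\}\Big|\ \leq\ \sum_{j=1}^{(n-1)^2+1}\binom{n!}{j}.$$
   Context: $\mathcal{B}_n$ denotes the set of $n\times n$ bistochastic matrices: real matrices with non-negative entries whose rows and columns each sum to $1$. $\|A\|_{\mathrm{F}}^2=\sum_{i,j=1}^{n}A_{i,j}^2$ is the squared Frobenius norm. The maximal trace of $A$ is $\mathrm{maxTrace}(A)=\max_{\sigma\in S_n}\sum_{i=1}^{n}A_{i,\sigma(i)}$, where $S_n$ is the set of permutations of $\{1,\ldots,n\}$. A matrix $A\in\mathcal{B}_n$ is an Erdős matrix if $\|A\|_{\mathrm{F}}^2=\mathrm{maxTrace}(A)$. *)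

theory Defs
  imports "HOL-Analysis.Analysis" "HOL-Combinatorics.Permutations"
begin

text \<open>An \<open>n \<times> n\<close> real matrix is an element of \<^typ>\<open>real ^ 'n ^ 'n\<close> with \<open>n = CARD('n)\<close>; the finite type
  \<open>'n\<close> plays the role of the index set \<open>{1, \<dots>, n}\<close>.\<close>

definition bistochastic :: "(real ^ 'n ^ 'n) set" where
  "bistochastic = {A. (\<forall>i j. 0 \<le> A $ i $ j) \<and>
                      (\<forall>i. (\<Sum>j\<in>UNIV. A $ i $ j) = 1) \<and>
                      (\<forall>j. (\<Sum>i\<in>UNIV. A $ i $ j) = 1)}"

definition frobenius_sq :: "real ^ 'n ^ 'n \<Rightarrow> real" where
  "frobenius_sq A = (\<Sum>i\<in>UNIV. \<Sum>j\<in>UNIV. (A $ i $ j)\<^sup>2)"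

lemma frobenius_sq_eq_norm: "frobenius_sq A = (norm A)\<^sup>2"
  unfolding frobenius_sq_def power2_norm_eq_inner inner_vec_def
  by (simp add: power2_eq_square)

text \<open>The maximum is over a finite nonempty set, so \<^const>\<open>Max\<close> is a genuine maximum.\<close>

definition max_trace :: "real ^ 'n ^ 'n \<Rightarrow> real" where
  "max_trace A = Max ((\<lambda>\<sigma>. \<Sum>i\<in>UNIV. A $ i $ \<sigma> i) ` {\<sigma>. \<sigma> permutes UNIV})"

definition erdos_matrix :: "real ^ 'n ^ 'n \<Rightarrow> bool" where
  "erdos_matrix A \<longleftrightarrow> A \<in> bistochastic \<and> frobenius_sq A = max_trace A"

end

theory Submission
  imports Defs
begin

text \<open>
  By the theorem of Birkhoff and von Neumann, a bistochastic matrix \<open>A\<close> is a convex combination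
  \<open>\<Sum>v\<in>T. u v *\<^sub>R v\<close> of permutation matrices with all weights positive. Write \<open>\<bullet>\<close> for the Frobenius
  inner product, so that \<^const>\<open>max_trace\<close> is the maximum of \<open>A \<bullet> v\<close> over all permutation matrices
  \<open>v\<close>. Then \<open>A \<bullet> A = (\<Sum>v\<in>T. u v * (A \<bullet> v))\<close> is a weighted average of numbers that are at most
  \<^term>\<open>max_trace A\<close>. Hence \<open>A\<close> is an Erdos matrix exactly when every \<open>v \<in> T\<close> attains the maximum, and
  in that case \<open>v \<mapsto> A \<bullet> v\<close> is constant on \<open>T\<close>.

  This makes \<open>T\<close> determine \<open>A\<close>. If \<open>A\<close> and \<open>B\<close> both lie in the convex hull of \<open>T\<close> and both have
  constant inner product with the points of \<open>T\<close>, then \<open>(A - B) \<bullet> v\<close> is constant on \<open>T\<close>, hence on its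
  convex hull; comparing the values at \<open>A\<close> and at \<open>B\<close> gives \<open>(A - B) \<bullet> (A - B) = 0\<close>.

  The permutation matrices differ from each other by matrices with zero row and column sums, a
  space of dimension at most \<open>(n - 1)\<^sup>2\<close>, so Caratheodory's theorem allows \<open>T\<close> to be chosen with at
  most \<open>(n - 1)\<^sup>2 + 1\<close> elements. The bound counts the nonempty sets of at most that many
  permutations. The counting argument has nothing to do with matrices and is carried out in
  \<open>card_self_maximisers_le\<close> for any finite set of points in a Euclidean space.

  Birkhoff's theorem is obtained from the Krein-Milman theorem and a dimension count. If some entry
  of \<open>A\<close> is strictly between 0 and 1, then every row and every column that meets the set \<open>F\<close> of such
  entries meets it at least twice, so \<open>F\<close> has at least as many elements as there are rows and columns
  meeting it. The row and column sum equations on matrices supported on \<open>F\<close> have one redundancy, as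
  the row sums and the column sums have the same total; so they have a nonzero solution, along which
  \<open>A\<close> can be perturbed in both directions. Extreme points therefore have entries 0 and 1 only.
\<close>

section \<open>Points of a convex hull that maximise their own linear functional\<close>

text \<open>The squared norm of \<open>A\<close> is the average, with the weights \<open>u\<close>, of the numbers \<open>A \<bullet> v\<close>. None of these
  exceeds the average, so with positive weights all of them equal it.\<close>

lemma self_maximiser_inner_eq_on_support:
  fixes A :: "'a::real_inner"
  assumes "finite T" and pos: "\<And>v. v \<in> T \<Longrightarrow> 0 < u v" and one: "sum u T = 1"
    and A: "A = (\<Sum>v\<in>T. u v *\<^sub>R v)" and max: "\<And>v. v \<in> T \<Longrightarrow> A \<bullet> v \<le> A \<bullet> A"
    and "v \<in> T"
  shows "A \<bullet> v = A \<bullet> A"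
proof -
  have "A \<bullet> A = (\<Sum>v\<in>T. u v * (A \<bullet> v))"
    by (subst (2) A) (simp add: inner_sum_right)
  moreover have "A \<bullet> A = (\<Sum>v\<in>T. u v * (A \<bullet> A))"
    using one by (simp flip: sum_distrib_right)
  ultimately have "(\<Sum>v\<in>T. u v * (A \<bullet> A - A \<bullet> v)) = 0"
    by (simp add: right_diff_distrib sum_subtractf)
  moreover have "0 \<le> u w * (A \<bullet> A - A \<bullet> w)" if "w \<in> T" for w
    using pos[OF that] max[OF that] by simp
  ultimately have "u v * (A \<bullet> A - A \<bullet> v) = 0"
    using \<open>finite T\<close> \<open>v \<in> T\<close> by (simp add: sum_nonneg_eq_0_iff)
  with pos[OF \<open>v \<in> T\<close>] show ?thesis by simp
qed

text \<open>All of \<open>T\<close> lies in a hyperplane orthogonal to \<open>A - B\<close>, and so do the two points \<open>A\<close> and \<open>B\<close> of its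
  hull; thus \<open>A - B\<close> is orthogonal to itself.\<close>

lemma eq_if_inner_const_on_common_hull:
  fixes A B :: "'a::real_inner"
  assumes A: "A \<in> convex hull T" and B: "B \<in> convex hull T"
    and cA: "\<And>v. v \<in> T \<Longrightarrow> A \<bullet> v = a" and cB: "\<And>v. v \<in> T \<Longrightarrow> B \<bullet> v = b"
  shows "A = B"
proof -
  have "convex {x. (A - B) \<bullet> x = a - b}" by (rule convex_hyperplane)
  moreover have "T \<subseteq> {x. (A - B) \<bullet> x = a - b}" by (auto simp: cA cB inner_diff_left)
  ultimately have "convex hull T \<subseteq> {x. (A - B) \<bullet> x = a - b}" by (rule hull_minimal[rotated])
  with A B have "(A - B) \<bullet> A = a - b" "(A - B) \<bullet> B = a - b" by blast+
  then have "(A - B) \<bullet> (A - B) = 0" by (simp add: inner_diff_right)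
  then show ?thesis by simp
qed

text \<open>Caratheodory's theorem with the points of weight zero discarded: only points of positive weight
  are forced to attain the maximum in \<open>self_maximiser_inner_eq_on_support\<close>.\<close>

lemma small_positive_support_of_hull_point:
  fixes P :: "'a::euclidean_space set"
  assumes "x \<in> convex hull P"
  obtains T u where "finite T" "T \<subseteq> P" "T \<noteq> {}" "int (card T) \<le> aff_dim P + 1"
    "\<And>v. v \<in> T \<Longrightarrow> 0 < u v" "sum u T = 1" "x = (\<Sum>v\<in>T. u v *\<^sub>R v)"
proof -
  obtain S where S: "finite S" "S \<subseteq> P" "int (card S) \<le> aff_dim P + 1" "x \<in> convex hull S"
    using assms caratheodory_aff_dim[of P] by blast
  then obtain u where u: "\<And>v. v \<in> S \<Longrightarrow> 0 \<le> u v" "sum u S = 1" "(\<Sum>v\<in>S. u v *\<^sub>R v) = x"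
    by (auto simp: convex_hull_finite)
  define T where "T = {v\<in>S. u v \<noteq> 0}"
  have T: "T \<subseteq> S" "finite T" using S by (auto simp: T_def)
  have "sum u T = sum u S"
    by (rule sum.mono_neutral_left) (use S T in \<open>auto simp: T_def\<close>)
  moreover have "(\<Sum>v\<in>T. u v *\<^sub>R v) = (\<Sum>v\<in>S. u v *\<^sub>R v)"
    by (rule sum.mono_neutral_left) (use S T in \<open>auto simp: T_def\<close>)
  moreover have "0 < u v" if "v \<in> T" for v
    using u(1)[of v] that by (auto simp: T_def)
  moreover have "card T \<le> card S" using S T by (simp add: card_mono)
  ultimately show ?thesis
    using S T u by (intro that[of T u]) (auto split: if_splits)
qed

lemma card_subsets_size_between:
  assumes "finite P"
  shows "card {T. T \<subseteq> P \<and> 1 \<le> card T \<and> card T \<le> N} = (\<Sum>j = 1..N. card P choose j)"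
proof -
  have "{T. T \<subseteq> P \<and> 1 \<le> card T \<and> card T \<le> N} = (\<Union>j\<in>{1..N}. {T. T \<subseteq> P \<and> card T = j})"
    by auto
  also have "card \<dots> = (\<Sum>j = 1..N. card {T. T \<subseteq> P \<and> card T = j})"
    using assms by (intro card_UN_disjoint) auto
  finally show ?thesis using assms by (simp add: n_subsets)
qed

text \<open>Since \<open>A \<bullet> A\<close> is an average of the values \<open>A \<bullet> v\<close> over \<open>v \<in> P\<close>, the defining inequality of \<open>E\<close> says
  that the linear functional \<open>A \<bullet> _\<close> attains its maximum over the hull at \<open>A\<close> itself. Mapping \<open>A\<close> to
  a small set of points of \<open>P\<close> that represents it with positive weights is injective on \<open>E\<close>.\<close>

theorem card_self_maximisers_le:
  fixes P :: "'a::euclidean_space set"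
  assumes "finite P" and dim: "aff_dim P + 1 \<le> int N"
  defines "E \<equiv> {A \<in> convex hull P. \<forall>v\<in>P. A \<bullet> v \<le> A \<bullet> A}"
  shows "finite E \<and> card E \<le> (\<Sum>j = 1..N. card P choose j)"
proof -
  define \<T> where "\<T> = {T. T \<subseteq> P \<and> 1 \<le> card T \<and> card T \<le> N}"
  have "\<exists>T. T \<in> \<T> \<and> A \<in> convex hull T \<and> (\<forall>v\<in>T. A \<bullet> v = A \<bullet> A)" if A: "A \<in> E" for A
  proof -
    from A have "A \<in> convex hull P" by (simp add: E_def)
    then obtain T u where T: "finite T" "T \<subseteq> P" "T \<noteq> {}" "int (card T) \<le> aff_dim P + 1"
      and u: "\<And>v. v \<in> T \<Longrightarrow> 0 < u v" "sum u T = 1" "A = (\<Sum>v\<in>T. u v *\<^sub>R v)"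
      by (rule small_positive_support_of_hull_point) blast
    have "A \<bullet> v = A \<bullet> A" if "v \<in> T" for v
      using self_maximiser_inner_eq_on_support[OF T(1) u _ that] A T(2) by (auto simp: E_def)
    moreover have "A \<in> convex hull T"
      using T(1) u by (auto simp: convex_hull_finite intro!: exI[of _ u] less_imp_le)
    moreover have "T \<in> \<T>"
      using T dim by (auto simp: \<T>_def Suc_le_eq card_gt_0_iff)
    ultimately show ?thesis by blast
  qed
  then obtain S where S: "\<And>A. A \<in> E \<Longrightarrow> S A \<in> \<T>"
      "\<And>A. A \<in> E \<Longrightarrow> A \<in> convex hull (S A)"
      "\<And>A v. A \<in> E \<Longrightarrow> v \<in> S A \<Longrightarrow> A \<bullet> v = A \<bullet> A"
    by metis
  have "inj_on S E"
  proof (rule inj_onI)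
    fix A B assume "A \<in> E" "B \<in> E" "S A = S B"
    then show "A = B"
      using S(2,3) by (metis eq_if_inner_const_on_common_hull)
  qed
  moreover have "S ` E \<subseteq> \<T>" using S(1) by blast
  moreover have "finite \<T>" using assms(1) by (simp add: \<T>_def)
  ultimately have "finite E \<and> card E \<le> card \<T>"
    by (meson card_inj_on_le inj_on_finite)
  then show ?thesis
    using card_subsets_size_between[OF assms(1)] by (simp add: \<T>_def)
qed

section \<open>Spaces of matrices with prescribed support\<close>

lemma inner_axis_axis_matrix:
  fixes x :: "real ^ 'm ^ 'n"
  shows "x \<bullet> axis i (axis j 1) = x $ i $ j"
  by (simp add: inner_axis)

lemma dim_matrices_supported_on:
  fixes F :: "('n::finite \<times> 'm::finite) set"
  shows "dim {x :: real ^ 'm ^ 'n. \<forall>i j. (i, j) \<notin> F \<longrightarrow> x $ i $ j = 0} = card F"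
proof -
  define e where "e = (\<lambda>(i, j). axis i (axis j 1) :: real ^ 'm ^ 'n)"
  have inj: "inj e" by (auto simp: inj_on_def e_def axis_eq_axis)
  have B: "(Basis :: (real ^ 'm ^ 'n) set) = range e"
    by (auto simp: Basis_vec_def e_def image_iff)
  have "{x :: real ^ 'm ^ 'n. \<forall>i j. (i, j) \<notin> F \<longrightarrow> x $ i $ j = 0}
      = {x. \<forall>b\<in>Basis. b \<notin> e ` F \<longrightarrow> x \<bullet> b = 0}"
    unfolding B using inj
    by (auto simp: inj_image_mem_iff e_def inner_axis_axis_matrix)
  then show ?thesis
    using dim_substandard[of "e ` F"] card_image[OF inj_on_subset[OF inj subset_UNIV], of F]
    unfolding B by (simp add: image_mono)
qed

text \<open>In coordinates: a homogeneous linear system with fewer equations than unknowns has a nontrivial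
  solution.\<close>

lemma linear_kernel_nontrivial_on_subspace:
  fixes f :: "'a::euclidean_space \<Rightarrow> 'b::euclidean_space"
  assumes f: "linear f" and V: "subspace V" and W: "f ` V \<subseteq> W" and less: "dim W < dim V"
  obtains x where "x \<in> V" "x \<noteq> 0" "f x = 0"
proof (rule ccontr)
  assume contra: "\<not> thesis"
  have "inj_on f (span V)"
  proof (rule inj_onI)
    fix x y assume "x \<in> span V" "y \<in> span V" "f x = f y"
    then have "x - y \<in> V" "f (x - y) = 0"
      using V f by (auto simp: subspace_diff linear_diff span_eq_iff[THEN iffD2])
    then show "x = y" using contra that by force
  qed
  then have "dim (f ` V) = dim V" by (rule dim_image_eq[OF f])
  with dim_subset[OF W] less show False by simp
qed

text \<open>A matrix with zero row and column sums is determined by its entries outside one row and one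
  column, since the sums then give the remaining entries.\<close>

lemma dim_zero_sum_matrices_le:
  "dim {x :: real ^ 'n ^ 'n. (\<forall>i. (\<Sum>j\<in>UNIV. x $ i $ j) = 0) \<and> (\<forall>j. (\<Sum>i\<in>UNIV. x $ i $ j) = 0)}
    \<le> (CARD('n::finite) - 1)\<^sup>2" (is "dim ?V \<le> _")
proof (rule ccontr)
  assume contra: "\<not> ?thesis"
  \<comment> \<open>The map \<open>f\<close> erases row and column \<open>z\<close>; any index would do.\<close>
  define z :: 'n where "z = undefined"
  define F where "F = (- {z}) \<times> (- {z})"
  define f :: "real ^ 'n ^ 'n \<Rightarrow> real ^ 'n ^ 'n"
    where "f x = (\<chi> i j. if (i, j) \<in> F then x $ i $ j else 0)" for x
  have f: "linear f"
    by (rule linearI) (auto simp: f_def vec_eq_iff)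
  have V: "subspace ?V"
    by (auto simp: subspace_def sum.distrib simp flip: sum_distrib_left)
  have "card F = (CARD('n) - 1)\<^sup>2"
    by (simp add: F_def card_cartesian_product Compl_eq_Diff_UNIV card_Diff_singleton power2_eq_square)
  then have less: "dim {x :: real ^ 'n ^ 'n. \<forall>i j. (i, j) \<notin> F \<longrightarrow> x $ i $ j = 0} < dim ?V"
    using contra by (simp add: dim_matrices_supported_on)
  have sub: "f ` ?V \<subseteq> {x. \<forall>i j. (i, j) \<notin> F \<longrightarrow> x $ i $ j = 0}"
    by (auto simp: f_def)
  obtain x where x: "x \<in> ?V" "x \<noteq> 0" "f x = 0"
    by (rule linear_kernel_nontrivial_on_subspace[OF f V sub less])
  have F0: "x $ i $ j = 0" if "i \<noteq> z" "j \<noteq> z" for i j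
    using x(3) that by (auto simp: f_def F_def vec_eq_iff split: if_splits)
  have row: "x $ i $ z = 0" if "i \<noteq> z" for i
  proof -
    have "0 = (\<Sum>j\<in>UNIV. x $ i $ j)" using x(1) by simp
    also have "\<dots> = x $ i $ z + (\<Sum>j\<in>UNIV - {z}. x $ i $ j)" by (simp add: sum.remove)
    finally show ?thesis using F0 that by simp
  qed
  have "x $ z $ j = 0" for j
  proof -
    have "0 = (\<Sum>i\<in>UNIV. x $ i $ j)" using x(1) by simp
    also have "\<dots> = x $ z $ j + (\<Sum>i\<in>UNIV - {z}. x $ i $ j)" by (simp add: sum.remove)
    also have "(\<Sum>i\<in>UNIV - {z}. x $ i $ j) = 0"
      using F0 row by (intro sum.neutral) (metis DiffD2 singletonI)
    finally show ?thesis by simp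
  qed
  then have "x = 0" using F0 row by (metis vec_eq_iff zero_index)
  with x(2) show False by simp
qed

text \<open>There is one unknown for each element of \<open>F\<close> and one equation for each row and each column that
  meets \<open>F\<close>. The nonstrict inequality \<open>large\<close> suffices because one equation is redundant: if all row
  sums vanish, the sum of the column sums vanishes as well.\<close>

lemma zero_sum_matrix_on_large_support:
  fixes F :: "('n::finite \<times> 'n) set"
  assumes "F \<noteq> {}" and large: "card (fst ` F) + card (snd ` F) \<le> card F"
  obtains D :: "real ^ 'n ^ 'n" where "D \<noteq> 0" "\<And>i j. (i, j) \<notin> F \<Longrightarrow> D $ i $ j = 0"
    "\<And>i. (\<Sum>j\<in>UNIV. D $ i $ j) = 0" "\<And>j. (\<Sum>i\<in>UNIV. D $ i $ j) = 0"
proof -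
  obtain c where c: "c \<in> snd ` F" using assms(1) by auto
  define V where "V = {x :: real ^ 'n ^ 'n. \<forall>i j. (i, j) \<notin> F \<longrightarrow> x $ i $ j = 0}"
  \<comment> \<open>The column equation of \<open>c\<close> is left out; \<open>K\<close> indexes the equations that remain.\<close>
  define K where "K = Inl ` fst ` F \<union> Inr ` (snd ` F - {c})"
  define g :: "real ^ 'n ^ 'n \<Rightarrow> real ^ ('n + 'n)"
    where "g x = (\<chi> k. case k of Inl i \<Rightarrow> \<Sum>j\<in>UNIV. x $ i $ j
                 | Inr j \<Rightarrow> if j = c then 0 else \<Sum>i\<in>UNIV. x $ i $ j)" for x
  have g: "linear g"
    by (rule linearI)
      (auto simp: g_def vec_eq_iff sum.distrib sum_distrib_left split: sum.splits)
  have V: "subspace V" by (auto simp: V_def subspace_def)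
  have "card K = card (fst ` F) + (card (snd ` F) - 1)"
    unfolding K_def using c by (subst card_Un_disjoint) (auto simp: card_image)
  moreover have "card (snd ` F) > 0" using c by (auto simp: card_gt_0_iff)
  ultimately have "card K < card F" using large by simp
  moreover have "dim V = card F"
    unfolding V_def by (rule dim_matrices_supported_on)
  ultimately have less: "dim {y :: real ^ ('n + 'n). \<forall>k. k \<notin> K \<longrightarrow> y $ k = 0} < dim V"
    by (simp add: dim_substandard_cart flip: dim_vec_eq)
  have sub: "g ` V \<subseteq> {y. \<forall>k. k \<notin> K \<longrightarrow> y $ k = 0}"
  proof clarify
    fix x k assume x: "x \<in> V" and k: "k \<notin> K"
    show "g x $ k = 0"
    proof (cases k)
      case (Inl i)
      with k have "(i, j) \<notin> F" for j by (force simp: K_def)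
      with x have "x $ i $ j = 0" for j by (simp add: V_def)
      with Inl show ?thesis by (simp add: g_def)
    next
      case (Inr j)
      with k have "j = c \<or> (i, j) \<notin> F" for i by (force simp: K_def)
      with x have "j = c \<or> x $ i $ j = 0" for i by (auto simp: V_def)
      with Inr show ?thesis by (auto simp: g_def)
    qed
  qed
  obtain D where D: "D \<in> V" "D \<noteq> 0" "g D = 0"
    by (rule linear_kernel_nontrivial_on_subspace[OF g V sub less])
  have row: "(\<Sum>j\<in>UNIV. D $ i $ j) = 0" for i
    using arg_cong[OF D(3), of "\<lambda>y. y $ Inl i"] by (simp add: g_def)
  have col': "(\<Sum>i\<in>UNIV. D $ i $ j) = 0" if "j \<noteq> c" for j
    using arg_cong[OF D(3), of "\<lambda>y. y $ Inr j"] that by (simp add: g_def)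
  have "0 = (\<Sum>j\<in>UNIV. \<Sum>i\<in>UNIV. D $ i $ j)"
    by (subst sum.swap) (simp add: row)
  also have "\<dots> = (\<Sum>i\<in>UNIV. D $ i $ c) + (\<Sum>j\<in>UNIV - {c}. \<Sum>i\<in>UNIV. D $ i $ j)"
    by (rule sum.remove) auto
  finally have "(\<Sum>i\<in>UNIV. D $ i $ c) = 0" using col' by simp
  with col' have "(\<Sum>i\<in>UNIV. D $ i $ j) = 0" for j by (cases "j = c") auto
  with D row show ?thesis by (intro that[of D]) (auto simp: V_def)
qed

section \<open>Bistochastic matrices and permutation matrices\<close>

definition perm_matrix :: "('n \<Rightarrow> 'n) \<Rightarrow> real ^ 'n ^ 'n" where
  "perm_matrix \<sigma> = (\<chi> i j. if j = \<sigma> i then 1 else 0)"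

definition perm_matrices :: "(real ^ 'n ^ 'n) set" where
  "perm_matrices = perm_matrix ` {\<sigma>. \<sigma> permutes UNIV}"

lemma inner_perm_matrix: "A \<bullet> perm_matrix \<sigma> = (\<Sum>i\<in>UNIV. A $ i $ \<sigma> i)"
  by (simp add: perm_matrix_def inner_vec_def if_distrib cong: if_cong)

lemma finite_perm_matrices: "finite (perm_matrices :: (real ^ 'n ^ 'n) set)"
  by (simp add: perm_matrices_def finite_permutations)

lemma card_perm_matrices: "card (perm_matrices :: (real ^ 'n ^ 'n) set) = fact CARD('n::finite)"
proof -
  have "inj (perm_matrix :: ('n \<Rightarrow> 'n) \<Rightarrow> _)"
    by (rule injI) (auto simp: perm_matrix_def vec_eq_iff fun_eq_iff split: if_splits, metis zero_neq_one)
  then have "card (perm_matrices :: (real ^ 'n ^ 'n) set) = card {\<sigma> :: 'n \<Rightarrow> 'n. \<sigma> permutes UNIV}"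
    unfolding perm_matrices_def by (intro card_image) (rule inj_on_subset, auto)
  then show ?thesis by (simp add: card_permutations)
qed

lemma perm_matrix_bistochastic:
  assumes "\<sigma> permutes (UNIV :: 'n::finite set)"
  shows "perm_matrix \<sigma> \<in> bistochastic"
proof -
  have "(\<Sum>i\<in>UNIV. if j = \<sigma> i then 1 else 0 :: real) = 1" for j
  proof -
    have "(j = \<sigma> i) = (i = inv \<sigma> j)" for i
      using permutes_inverses[OF assms] by metis
    then show ?thesis by simp
  qed
  then show ?thesis by (simp add: bistochastic_def perm_matrix_def)
qed

text \<open>Translated by one of its points, the set of permutation matrices lies in the space of matrices
  with zero row and column sums.\<close>

lemma aff_dim_perm_matrices_le:
  "aff_dim (perm_matrices :: (real ^ 'n ^ 'n) set) \<le> int ((CARD('n::finite) - 1)\<^sup>2)"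
proof -
  define P where "P = (perm_matrices :: (real ^ 'n ^ 'n) set)"
  define a :: "real ^ 'n ^ 'n" where "a = perm_matrix id"
  have a: "a \<in> P" by (auto simp: P_def a_def perm_matrices_def permutes_id)
  have P: "x \<in> bistochastic" if "x \<in> P" for x
    using that by (auto simp: P_def perm_matrices_def perm_matrix_bistochastic)
  have "0 \<in> (+) (- a) ` P" using a by (auto simp: image_iff)
  then have "aff_dim P = int (dim ((+) (- a) ` P))"
    using aff_dim_zero aff_dim_translation_eq hull_inc by metis
  also have "dim ((+) (- a) ` P) \<le> dim {x :: real ^ 'n ^ 'n.
      (\<forall>i. (\<Sum>j\<in>UNIV. x $ i $ j) = 0) \<and> (\<forall>j. (\<Sum>i\<in>UNIV. x $ i $ j) = 0)}"
    using P[OF a] P by (intro dim_subset) (auto simp: bistochastic_def sum_subtractf)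
  also have "\<dots> \<le> (CARD('n) - 1)\<^sup>2" by (rule dim_zero_sum_matrices_le)
  finally show ?thesis by (simp add: P_def)
qed

section \<open>The theorem of Birkhoff and von Neumann\<close>

lemma convex_bistochastic: "convex (bistochastic :: (real ^ 'n ^ 'n) set)"
  by (auto simp: convex_def bistochastic_def sum.distrib simp flip: sum_distrib_left)

lemma bistochastic_le_1:
  assumes "A \<in> bistochastic"
  shows "A $ i $ j \<le> 1"
  using assms member_le_sum[of j UNIV "\<lambda>j. A $ i $ j"] by (auto simp: bistochastic_def)

lemma compact_bistochastic: "compact (bistochastic :: (real ^ 'n ^ 'n) set)"
proof -
  have "closed (bistochastic :: (real ^ 'n ^ 'n) set)"
    unfolding bistochastic_def
    by (intro closed_Collect_conj closed_Collect_all closed_Collect_le closed_Collect_eq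
        continuous_intros)
  moreover have "norm A \<le> CARD('n) * CARD('n)" if "A \<in> bistochastic" for A :: "real ^ 'n ^ 'n"
  proof -
    have "norm (A $ i) \<le> CARD('n)" for i
    proof -
      have "norm (A $ i) \<le> (\<Sum>j\<in>UNIV. \<bar>A $ i $ j\<bar>)" by (rule norm_le_l1_cart)
      also have "\<dots> \<le> (\<Sum>j\<in>(UNIV :: 'n set). 1)"
        using bistochastic_le_1[OF that] that by (intro sum_mono) (auto simp: bistochastic_def)
      finally show ?thesis by simp
    qed
    then have "(\<Sum>i\<in>UNIV. norm (A $ i)) \<le> (\<Sum>i\<in>(UNIV :: 'n set). real CARD('n))"
      by (intro sum_mono)
    moreover have "norm A \<le> (\<Sum>i\<in>UNIV. norm (A $ i))"
      unfolding norm_vec_def by (rule L2_set_le_sum) auto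
    ultimately show ?thesis by simp
  qed
  then have "bounded (bistochastic :: (real ^ 'n ^ 'n) set)" by (rule boundedI)
  ultimately show ?thesis by (simp add: compact_eq_bounded_closed)
qed

text \<open>The summands other than \<open>f j\<close> add up to \<open>1 - f j\<close>, which is strictly between 0 and 1.\<close>

lemma another_fractional_summand:
  fixes f :: "'a::finite \<Rightarrow> real"
  assumes nn: "\<And>j. 0 \<le> f j" and one: "sum f UNIV = 1" and j: "f j < 1" "0 < f j"
  obtains k where "k \<noteq> j" "0 < f k" "f k < 1"
proof -
  have *: "sum f UNIV = f j + sum f (UNIV - {j})" by (rule sum.remove) auto
  with one j have "sum f (UNIV - {j}) \<noteq> 0" by simp
  then obtain k where k: "k \<noteq> j" "f k \<noteq> 0" by (auto dest: sum.not_neutral_contains_not_neutral)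
  moreover have "f k \<le> sum f (UNIV - {j})" using k nn by (intro member_le_sum) auto
  ultimately show ?thesis using * one j nn[of k] by (intro that[of k]) auto
qed

lemma card_image_doubled_le:
  assumes "finite F" and two: "\<And>x. x \<in> F \<Longrightarrow> \<exists>y\<in>F. y \<noteq> x \<and> h y = h x"
  shows "2 * card (h ` F) \<le> card F"
proof -
  have "2 \<le> card {x\<in>F. h x = r}" if r: "r \<in> h ` F" for r
  proof -
    obtain x y where "x \<in> F" "y \<in> F" "y \<noteq> x" "h x = r" "h y = r" using r two by blast
    then have "card {x, y} \<le> card {x\<in>F. h x = r}" using assms(1) by (intro card_mono) auto
    with \<open>y \<noteq> x\<close> show ?thesis by simp
  qed
  then have "(\<Sum>r\<in>h ` F. 2) \<le> (\<Sum>r\<in>h ` F. card {x\<in>F. h x = r})" by (rule sum_mono)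
  also have "\<dots> = card F"
    using sum.image_gen[OF assms(1), of "\<lambda>_. 1 :: nat" h] by simp
  finally show ?thesis by simp
qed

text \<open>If there were fractional entries, they would carry a nonzero matrix \<open>D\<close> with zero row and column
  sums, and \<open>A\<close> would be the midpoint of \<open>A + \<epsilon> D\<close> and \<open>A - \<epsilon> D\<close> for a small \<open>\<epsilon>\<close>. Taking \<^emph>\<open>all\<close>
  fractional entries at once puts at least two of them into each row and column that has any, which is
  the abundance of unknowns that \<open>zero_sum_matrix_on_large_support\<close> asks for.\<close>

lemma extreme_bistochastic_integral:
  fixes A :: "real ^ 'n ^ 'n"
  assumes "A extreme_point_of bistochastic"
  shows "A $ i $ j = 0 \<or> A $ i $ j = 1"
proof (rule ccontr)
  assume frac: "\<not> ?thesis"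
  have A: "A \<in> bistochastic" using assms by (simp add: extreme_point_of_def)
  then have nn: "0 \<le> A $ i $ j" and row: "(\<Sum>j\<in>UNIV. A $ i $ j) = 1"
    and col: "(\<Sum>i\<in>UNIV. A $ i $ j) = 1" for i j
    by (auto simp: bistochastic_def)
  define F where "F = {(i, j). 0 < A $ i $ j \<and> A $ i $ j < 1}"
  have "(i, j) \<in> F"
    using frac nn[of i j] bistochastic_le_1[OF A, of i j] by (auto simp: F_def)
  then have "F \<noteq> {}" by blast
  have "2 * card (fst ` F) \<le> card F"
  proof (rule card_image_doubled_le, simp, clarify)
    fix i j assume "(i, j) \<in> F"
    then obtain k where "k \<noteq> j" "0 < A $ i $ k" "A $ i $ k < 1"
      using another_fractional_summand[of "\<lambda>j. A $ i $ j" j] nn row by (auto simp: F_def)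
    then show "\<exists>y\<in>F. y \<noteq> (i, j) \<and> fst y = fst (i, j)"
      by (intro bexI[of _ "(i, k)"]) (auto simp: F_def)
  qed
  moreover have "2 * card (snd ` F) \<le> card F"
  proof (rule card_image_doubled_le, simp, clarify)
    fix i j assume "(i, j) \<in> F"
    then obtain k where "k \<noteq> i" "0 < A $ k $ j" "A $ k $ j < 1"
      using another_fractional_summand[of "\<lambda>i. A $ i $ j" i] nn col by (auto simp: F_def)
    then show "\<exists>y\<in>F. y \<noteq> (i, j) \<and> snd y = snd (i, j)"
      by (intro bexI[of _ "(k, j)"]) (auto simp: F_def)
  qed
  ultimately have "card (fst ` F) + card (snd ` F) \<le> card F" by simp
  then obtain D :: "real ^ 'n ^ 'n" where "D \<noteq> 0" and supp: "\<And>i j. (i, j) \<notin> F \<Longrightarrow> D $ i $ j = 0"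
    and D: "\<And>i. (\<Sum>j\<in>UNIV. D $ i $ j) = 0" "\<And>j. (\<Sum>i\<in>UNIV. D $ i $ j) = 0"
    by (rule zero_sum_matrix_on_large_support[OF \<open>F \<noteq> {}\<close>]) blast
  \<comment> \<open>Entries of \<open>D\<close> are bounded by its norm, so this \<open>\<epsilon>\<close> keeps every entry of \<open>A \<plusminus> \<epsilon> D\<close> nonnegative.\<close>
  define \<delta> where "\<delta> = Min ((\<lambda>(i, j). A $ i $ j) ` F)"
  have "\<delta> > 0" using \<open>F \<noteq> {}\<close> by (auto simp: \<delta>_def F_def)
  define \<epsilon> where "\<epsilon> = \<delta> / norm D"
  have "\<epsilon> > 0" using \<open>\<delta> > 0\<close> \<open>D \<noteq> 0\<close> by (simp add: \<epsilon>_def)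
  have small: "\<epsilon> * \<bar>D $ i $ j\<bar> \<le> A $ i $ j" for i j
  proof (cases "(i, j) \<in> F")
    case True
    have "\<bar>D $ i $ j\<bar> \<le> norm D"
      by (meson component_le_norm_cart Finite_Cartesian_Product.norm_nth_le order.trans)
    then have "\<epsilon> * \<bar>D $ i $ j\<bar> \<le> \<epsilon> * norm D" using \<open>\<epsilon> > 0\<close> by simp
    also have "\<dots> = \<delta>" using \<open>D \<noteq> 0\<close> by (simp add: \<epsilon>_def)
    also have "\<delta> \<le> A $ i $ j" unfolding \<delta>_def using True by (intro Min_le) auto
    finally show ?thesis .
  qed (use supp nn in auto)
  have mem: "A + s *\<^sub>R D \<in> bistochastic" if "\<bar>s\<bar> = \<epsilon>" for s
  proof -
    have "0 \<le> A $ i $ j + s * D $ i $ j" for i j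
      using small[of i j] abs_mult[of s "D $ i $ j"] unfolding that by linarith
    then show ?thesis
      by (simp add: bistochastic_def sum.distrib row col D flip: sum_distrib_left)
  qed
  have "A = midpoint (A + \<epsilon> *\<^sub>R D) (A + (- \<epsilon>) *\<^sub>R D)"
    by (simp add: midpoint_def vec_eq_iff)
  moreover have "A + \<epsilon> *\<^sub>R D \<noteq> A + (- \<epsilon>) *\<^sub>R D"
  proof
    assume "A + \<epsilon> *\<^sub>R D = A + (- \<epsilon>) *\<^sub>R D"
    then have "(\<epsilon> - - \<epsilon>) *\<^sub>R D = 0"
      by (metis add_left_cancel right_minus_eq scaleR_left_diff_distrib)
    with \<open>\<epsilon> > 0\<close> \<open>D \<noteq> 0\<close> show False by simp
  qed
  ultimately have "A \<in> open_segment (A + \<epsilon> *\<^sub>R D) (A + (- \<epsilon>) *\<^sub>R D)"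
    using midpoint_in_open_segment by metis
  then show False
    using assms mem[of \<epsilon>] mem[of "- \<epsilon>"] \<open>\<epsilon> > 0\<close> by (auto simp: extreme_point_of_def)
qed

lemma integral_bistochastic_is_perm_matrix:
  fixes A :: "real ^ 'n ^ 'n"
  assumes A: "A \<in> bistochastic" and int: "\<And>i j. A $ i $ j = 0 \<or> A $ i $ j = 1"
  shows "A \<in> perm_matrices"
proof -
  have row: "(\<Sum>j\<in>UNIV. A $ i $ j) = 1" and col: "(\<Sum>i\<in>UNIV. A $ i $ j) = 1" for i j
    using A by (auto simp: bistochastic_def)
  have "\<exists>j. A $ i $ j = 1" for i
  proof (rule ccontr)
    assume "\<nexists>j. A $ i $ j = 1"
    then have "(\<Sum>j\<in>UNIV. A $ i $ j) = 0" using int by (intro sum.neutral) metis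
    with row[of i] show False by simp
  qed
  then obtain \<sigma> where \<sigma>: "\<And>i. A $ i $ \<sigma> i = 1" by metis
  have zero: "A $ i $ j = 0" if "j \<noteq> \<sigma> i" for i j
  proof -
    have "(\<Sum>k\<in>{j, \<sigma> i}. A $ i $ k) \<le> (\<Sum>k\<in>UNIV. A $ i $ k)"
      using A by (intro sum_mono2) (auto simp: bistochastic_def)
    with that row[of i] \<sigma>[of i] int[of i j] show ?thesis by auto
  qed
  have "surj \<sigma>"
    unfolding surj_def
  proof
    fix j
    show "\<exists>i. j = \<sigma> i"
    proof (rule ccontr)
      assume "\<nexists>i. j = \<sigma> i"
      then have "(\<Sum>i\<in>UNIV. A $ i $ j) = 0" using zero by (intro sum.neutral) metis
      with col[of j] show False by simp
    qed
  qed
  then have "bij \<sigma>" by (simp add: bij_def finite_UNIV_surj_inj)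
  then have "\<sigma> permutes UNIV" by (intro bij_imp_permutes) auto
  moreover have "A = perm_matrix \<sigma>"
    using \<sigma> zero by (auto simp: perm_matrix_def vec_eq_iff)
  ultimately show ?thesis by (auto simp: perm_matrices_def)
qed

theorem bistochastic_subset_hull_perm_matrices:
  "(bistochastic :: (real ^ 'n ^ 'n) set) \<subseteq> convex hull perm_matrices"
proof -
  have "bistochastic = convex hull {A :: real ^ 'n ^ 'n. A extreme_point_of bistochastic}"
    by (rule Krein_Milman_Minkowski[OF compact_bistochastic convex_bistochastic])
  also have "\<dots> \<subseteq> convex hull perm_matrices"
    using integral_bistochastic_is_perm_matrix extreme_bistochastic_integral
    by (intro hull_mono) (auto simp: extreme_point_of_def)
  finally show ?thesis .
qed

section \<open>Counting\<close>

lemma frobenius_sq_eq_inner: "frobenius_sq A = A \<bullet> A"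
  by (simp add: frobenius_sq_eq_norm power2_norm_eq_inner)

lemma inner_perm_matrix_le_max_trace:
  assumes "P \<in> perm_matrices"
  shows "A \<bullet> P \<le> max_trace A"
  using assms unfolding max_trace_def
  by (intro Max_ge) (auto simp: perm_matrices_def inner_perm_matrix finite_permutations)

theorem theorem1p3:
  assumes "CARD('n::finite) \<ge> 4"
  shows "finite {A :: real ^ 'n ^ 'n. erdos_matrix A} \<and>
         card {A :: real ^ 'n ^ 'n. erdos_matrix A}
           \<le> (\<Sum>j = 1..(CARD('n) - 1)\<^sup>2 + 1. (fact CARD('n) :: nat) choose j)"
proof -
  define E where "E = {A \<in> convex hull (perm_matrices :: (real ^ 'n ^ 'n) set).
    \<forall>P\<in>perm_matrices. A \<bullet> P \<le> A \<bullet> A}"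
  have sub: "{A :: real ^ 'n ^ 'n. erdos_matrix A} \<subseteq> E"
    using bistochastic_subset_hull_perm_matrices inner_perm_matrix_le_max_trace
    by (auto simp: erdos_matrix_def E_def simp flip: frobenius_sq_eq_inner)
  have E: "finite E \<and> card E \<le> (\<Sum>j = 1..(CARD('n) - 1)\<^sup>2 + 1. (fact CARD('n) :: nat) choose j)"
    using card_self_maximisers_le[OF finite_perm_matrices, where N = "(CARD('n) - 1)\<^sup>2 + 1"]
      aff_dim_perm_matrices_le
    unfolding E_def card_perm_matrices by simp
  with sub show ?thesis by (meson card_mono finite_subset order.trans)
qed

end
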